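(* Let $G_w$ be a weighted $\infty$-graph of order $n$ having at least one pendant vertex. Then $i_+(G_w)\ge 3$, $i_-(G_w)\ge 3$ and $i_0(G_w)\le n-6$.
   Context: A weighted graph $G_w$ is a simple graph $G$ with a positive weight on each edge; its adjacency matrix has entry $w(v_iv_j)$ if $v_iv_j\in E(G)$ and $0$ otherwise, and $i_+(G_w)$, $i_-(G_w)$, $i_0(G_w)$ are the numbers of positive, negative, zero eigenvalues of this matrix, with multiplicity. A bicyclic graph is a connected simple graph with $|E|=|V|+1$; its base is its unique bicyclic subgraph with no pendant vertices. For $p,q\ge3$, $l\ge1$, $\infty(p,l,q)$ is obtained from vertex-disjoint cycles $C^p$, $C^q$ and a path $v_1\cdots v_l$ by identifying $v_1$ with a vertex of $C^p$ and $v_l$ with a vertex of $C^q$. A (weighted) $\infty$-graph is a (weighted) bicyclic graph whose base is $\infty(p,l,q)$ for some $p,q\ge 3$, $l\ge 1$. *)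

theory Defs
  imports "Graph_Theory.Graph_Theory" "Jordan_Normal_Form.Char_Poly"
begin

text \<open>A simple graph is a \<^locale>\<open>pair_graph\<close>: finite, loop-free, with a symmetric arc relation,
  so that every undirected edge \<open>{u, v}\<close> is present as the two arcs \<open>(u, v)\<close> and \<open>(v, u)\<close>.\<close>

definition edges :: "'a pair_pre_digraph \<Rightarrow> 'a set set" where
  "edges G = (\<lambda>(u, v). {u, v}) ` parcs G"

definition pendant :: "'a pair_pre_digraph \<Rightarrow> 'a \<Rightarrow> bool" where
  "pendant G v \<longleftrightarrow> v \<in> pverts G \<and> out_degree (with_proj G) v = 1"

definition weighted_graph :: "'a pair_pre_digraph \<Rightarrow> ('a set \<Rightarrow> real) \<Rightarrow> bool" where
  "weighted_graph G w \<longleftrightarrow> pair_graph G \<and> (\<forall>e\<in>edges G. 0 < w e)"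

definition bicyclic :: "'a pair_pre_digraph \<Rightarrow> bool" where
  "bicyclic G \<longleftrightarrow> pair_graph G \<and> connected (with_proj G) \<and> card (edges G) = card (pverts G) + 1"

text \<open>Every bicyclic graph has exactly one base, so the base is treated as a relation here.\<close>

definition is_base :: "'a pair_pre_digraph \<Rightarrow> 'a pair_pre_digraph \<Rightarrow> bool" where
  "is_base H G \<longleftrightarrow>
     subgraph (with_proj H) (with_proj G) \<and> bicyclic H \<and> (\<nexists>v. pendant H v)"

definition path_arcs :: "'a list \<Rightarrow> ('a \<times> 'a) set" where
  "path_arcs vs = {(vs ! i, vs ! Suc i) | i. Suc i < length vs}
                \<union> {(vs ! Suc i, vs ! i) | i. Suc i < length vs}"

definition cycle_arcs :: "'a list \<Rightarrow> ('a \<times> 'a) set" where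
  "cycle_arcs cs = {(cs ! i, cs ! (Suc i mod length cs)) | i. i < length cs}
                 \<union> {(cs ! (Suc i mod length cs), cs ! i) | i. i < length cs}"

text \<open>\<open>H\<close> is (isomorphic to) \<open>\<infinity>(p, l, q)\<close>, for \<open>p, q \<ge> 3\<close> and \<open>l \<ge> 1\<close>: it is made up of a cycle \<open>cs\<close>
  of length \<open>p\<close>, a cycle \<open>ds\<close> of length \<open>q\<close> and a path \<open>vs\<close> on \<open>l\<close> vertices, which share exactly
  the vertices identified in the construction: the first path vertex lies on \<open>cs\<close>, the last one
  on \<open>ds\<close>. If \<open>l = 1\<close> these coincide, and the two cycles meet in that vertex only; if \<open>l \<ge> 2\<close>,
  the intersection conditions force the two cycles to be disjoint.\<close>

definition is_infinity :: "nat \<Rightarrow> nat \<Rightarrow> nat \<Rightarrow> 'a pair_pre_digraph \<Rightarrow> bool" where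
  "is_infinity p l q H \<longleftrightarrow>
     (\<exists>cs vs ds.
        distinct cs \<and> length cs = p \<and>
        distinct vs \<and> length vs = l \<and>
        distinct ds \<and> length ds = q \<and>
        set cs \<inter> set vs = {hd vs} \<and>
        set ds \<inter> set vs = {last vs} \<and>
        set cs \<inter> set ds \<subseteq> set vs \<and>
        pverts H = set cs \<union> set vs \<union> set ds \<and>
        parcs H = cycle_arcs cs \<union> path_arcs vs \<union> cycle_arcs ds)"

definition infinity_graph :: "'a pair_pre_digraph \<Rightarrow> bool" where
  "infinity_graph G \<longleftrightarrow>
     bicyclic G \<and>
     (\<exists>H p l q. is_base H G \<and> 3 \<le> p \<and> 3 \<le> q \<and> 1 \<le> l \<and> is_infinity p l q H)"

text \<open>The rows and columns are indexed by an enumeration \<open>xs\<close> of the vertices.\<close>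

definition adjacency_matrix ::
  "'a pair_pre_digraph \<Rightarrow> ('a set \<Rightarrow> real) \<Rightarrow> 'a list \<Rightarrow> real mat" where
  "adjacency_matrix G w xs = mat (length xs) (length xs)
     (\<lambda>(i, j). if (xs ! i, xs ! j) \<in> parcs G then w {xs ! i, xs ! j} else 0)"

text \<open>Numbers of eigenvalues, with multiplicity. The matrices concerned are real symmetric, so all
  their eigenvalues are real.\<close>

definition i_pos :: "real mat \<Rightarrow> nat" where
  "i_pos A = (\<Sum>x | eigenvalue A x \<and> 0 < x. Polynomial.order x (char_poly A))"

definition i_neg :: "real mat \<Rightarrow> nat" where
  "i_neg A = (\<Sum>x | eigenvalue A x \<and> x < 0. Polynomial.order x (char_poly A))"

definition i_zero :: "real mat \<Rightarrow> nat" where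
  "i_zero A = (\<Sum>x | eigenvalue A x \<and> x = 0. Polynomial.order x (char_poly A))"

end

(* The base of a bicyclic graph is an induced subgraph. Let v1 be pendant with neighbour u1. One
   of the two cycles of the base, minus its attachment vertex, misses u1; it contains an edge
   u3 v3. On the other cycle pick v2 different from the attachment vertex and from u1, with a
   neighbour u2 on that cycle different from u1. Then v1, v2, v3 are pairwise nonadjacent and the
   block of the adjacency matrix with rows u1, u2, u3 and columns v1, v2, v3 is triangular with
   nonzero diagonal, so the form is nondegenerate on six coordinates and has a three-dimensional
   isotropic subspace there. This forces three positive and three negative eigenvalues. *)

theory Submission
  imports Defs "Jordan_Normal_Form.Jordan_Normal_Form_Existence"
begin

section \<open>Inertia of real symmetric matrices\<close>

text \<open>For an eigenvector \<open>v\<close>, the Hermitian form \<open>q\<close> is its own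
  conjugate by symmetry, and it equals \<open>z * s\<close> with \<open>s\<close> the squared norm
  of \<open>v\<close>, a nonzero real number.\<close>

lemma symmetric_eigenvalue_real:
  fixes A :: "real mat"
  assumes A: "A \<in> carrier_mat n n"
    and sym: "\<And>i j. i < n \<Longrightarrow> j < n \<Longrightarrow> A $$ (i, j) = A $$ (j, i)"
    and ev: "eigenvalue (map_mat complex_of_real A) z"
  shows "z \<in> \<real>"
proof -
  let ?A = "map_mat complex_of_real A"
  from ev A obtain v where v: "v \<in> carrier_vec n" and v0: "v \<noteq> 0\<^sub>v n" and e: "?A *\<^sub>v v = z \<cdot>\<^sub>v v"
    unfolding eigenvalue_def eigenvector_def by auto
  have row: "(\<Sum>j<n. A $$ (i, j) * v $ j) = z * v $ i" if "i < n" for i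
  proof -
    have "(?A *\<^sub>v v) $ i = (\<Sum>j<n. A $$ (i, j) * v $ j)"
      using that A v by (auto simp: scalar_prod_def lessThan_atLeast0)
    then show ?thesis using e that v by simp
  qed
  define s where "s = (\<Sum>i<n. cnj (v $ i) * v $ i)"
  define q where "q = (\<Sum>i<n. \<Sum>j<n. cnj (v $ i) * A $$ (i, j) * v $ j)"
  have qs: "q = z * s"
    unfolding q_def s_def sum_distrib_left
  proof (rule sum.cong[OF refl])
    fix i assume "i \<in> {..<n}"
    moreover have "(\<Sum>j<n. cnj (v $ i) * A $$ (i, j) * v $ j) = cnj (v $ i) * (\<Sum>j<n. A $$ (i, j) * v $ j)"
      by (simp add: sum_distrib_left mult.assoc)
    ultimately show "(\<Sum>j<n. cnj (v $ i) * A $$ (i, j) * v $ j) = z * (cnj (v $ i) * v $ i)"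
      using row[of i] by simp
  qed
  have "cnj q = (\<Sum>i<n. \<Sum>j<n. cnj (v $ j) * A $$ (j, i) * v $ i)"
    unfolding q_def cnj_sum by (intro sum.cong refl) (simp add: sym mult_ac)
  also have "\<dots> = q" unfolding q_def by (rule sum.swap)
  finally have "cnj q = q" .
  moreover have s: "s = of_real (\<Sum>i<n. (cmod (v $ i))\<^sup>2)"
    unfolding s_def of_real_sum by (intro sum.cong refl) (metis complex_norm_square mult.commute)
  moreover have "s \<noteq> 0"
  proof -
    from v v0 obtain i where i: "i < n" "v $ i \<noteq> 0" by (auto simp: vec_eq_iff)
    then have "(\<Sum>i<n. (cmod (v $ i))\<^sup>2) > 0"
      by (intro sum_pos2[of _ i]) auto
    then show ?thesis unfolding s of_real_eq_0_iff by linarith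
  qed
  ultimately have "cnj z = z" using qs by simp
  then show ?thesis using Reals_cnj_iff by blast
qed

text \<open>Over the complex numbers the polynomial splits; its roots are eigenvalues, hence real,
  and the factorization descends because the embedding of real polynomials is injective. The
  splitting gives a Jordan normal form over the reals.\<close>

lemma symmetric_char_poly_splits:
  fixes A :: "real mat"
  assumes A: "A \<in> carrier_mat n n"
    and sym: "\<And>i j. i < n \<Longrightarrow> j < n \<Longrightarrow> A $$ (i, j) = A $$ (j, i)"
  shows "\<exists>es. char_poly A = (\<Prod>e\<leftarrow>es. [:- e, 1:])"
proof -
  let ?A = "map_mat complex_of_real A"
  interpret map_poly_inj_comm_ring_hom complex_of_real ..
  have cA: "?A \<in> carrier_mat n n" using A by simp
  from char_poly_factorized[OF cA] obtain as where as: "char_poly ?A = (\<Prod>a\<leftarrow>as. [:- a, 1:])" by blast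
  have "a \<in> \<real>" if "a \<in> set as" for a
  proof -
    have "poly (char_poly ?A) a = 0" unfolding as poly_prod_list using that
      by (auto simp: prod_list_zero_iff o_def image_iff intro!: bexI[of _ a])
    then show ?thesis using symmetric_eigenvalue_real[OF A sym] eigenvalue_root_char_poly[OF cA] by blast
  qed
  then have re: "as = map complex_of_real (map Re as)" by (simp add: map_idI o_def)
  have "map_poly complex_of_real (char_poly A) = char_poly ?A"
    by (rule of_real_hom.char_poly_hom[OF A, symmetric])
  also have "\<dots> = map_poly complex_of_real (\<Prod>e\<leftarrow>map Re as. [:- e, 1:])"
    unfolding as by (subst re) (simp add: hom_prod_list o_def)
  finally have "char_poly A = (\<Prod>e\<leftarrow>map Re as. [:- e, 1:])" by simp
  then show ?thesis by blast
qed

section \<open>Diagonalization through the Jordan normal form\<close>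

text \<open>A nonzero off-diagonal entry lies inside a single Jordan block. The induction peels off
  the first block and shifts the indices by its size.\<close>

lemma jordan_matrix_entries:
  fixes n_as :: "(nat \<times> 'a :: {zero, one}) list"
  assumes "i < sum_list (map fst n_as)" "j < sum_list (map fst n_as)"
  shows "jordan_matrix n_as $$ (i, j) \<noteq> 0 \<Longrightarrow> i \<noteq> j \<Longrightarrow>
     Suc i = j \<and> jordan_matrix n_as $$ (i, j) = 1
       \<and> jordan_matrix n_as $$ (i, i) = jordan_matrix n_as $$ (j, j)"
  using assms
proof (induction n_as arbitrary: i j)
  case Nil
  then show ?case by simp
next
  case (Cons p n_as)
  obtain n a where p: "p = (n, a)" by force
  show ?case
    using Cons.prems Cons.IH[of "i - n" "j - n"]
    unfolding p jordan_matrix_Cons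
    by (auto split: if_splits simp: not_less eq_diff_iff Suc_diff_le[symmetric])
qed

text \<open>The vectors \<open>p i\<close> are the columns of the base change \<open>P\<close> to
  Jordan form, and the \<open>r i\<close> are the coordinate functionals, the rows of its inverse
  \<open>Q\<close>. Symmetry rules out ones on the superdiagonal, so all columns are
  eigenvectors.\<close>

lemma symmetric_eigenbasis:
  fixes A :: "real mat"
  assumes A: "A \<in> carrier_mat n n"
    and sym: "\<And>i j. i < n \<Longrightarrow> j < n \<Longrightarrow> A $$ (i, j) = A $$ (j, i)"
  obtains e :: "nat \<Rightarrow> real" and p r :: "nat \<Rightarrow> nat \<Rightarrow> real"
  where "char_poly A = (\<Prod>i\<leftarrow>[0..<n]. [:- e i, 1:])"
    and "\<And>i k. i < n \<Longrightarrow> k < n \<Longrightarrow> (\<Sum>j<n. A $$ (k, j) * p i j) = e i * p i k"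
    and "\<And>x k. k < n \<Longrightarrow> (\<Sum>i<n. (\<Sum>j<n. r i j * x j) * p i k) = x k"
proof -
  obtain n_as where jnf: "jordan_nf A n_as"
    using symmetric_char_poly_splits[OF A sym] jordan_nf_exists[OF A] by blast
  define J where "J = jordan_matrix n_as"
  from jnf have simi: "similar_mat A J" unfolding jordan_nf_def J_def by auto
  then obtain P Q where "similar_mat_wit A J P Q" unfolding similar_mat_def by blast
  from similar_mat_witD2[OF A this]
  have PQ: "P * Q = 1\<^sub>m n" and QP: "Q * P = 1\<^sub>m n" and AJ: "A = P * J * Q"
    and J: "J \<in> carrier_mat n n" and P: "P \<in> carrier_mat n n" and Q: "Q \<in> carrier_mat n n" by auto
  have n: "n = sum_list (map fst n_as)" using J unfolding J_def by auto
  have Jent: "Suc i = j \<and> J $$ (i, j) = 1 \<and> J $$ (i, i) = J $$ (j, j)"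
    if "i < n" "j < n" "J $$ (i, j) \<noteq> 0" "i \<noteq> j" for i j
    using jordan_matrix_entries[of i n_as j] that unfolding J_def n by blast
  have AP: "A * P = P * J"
  proof -
    have "A * P = P * J * (Q * P)" unfolding AJ using P Q J by (simp add: assoc_mult_mat[of _ n n _ n _ n])
    then show ?thesis unfolding QP using P J by simp
  qed
  define p where "p i k = P $$ (k, i)" for i k
  have step: "(\<Sum>j<n. A $$ (k, j) * p i j) = (\<Sum>j<n. p j k * J $$ (j, i))"
    if "i < n" "k < n" for i k
    using arg_cong[OF AP, of "\<lambda>M. M $$ (k, i)"] that A P J
    by (simp add: scalar_prod_def p_def lessThan_atLeast0)
  \<comment> \<open>Column \<open>i\<close> of \<open>P\<close> is an eigenvector once the entry of
    \<open>J\<close> just above the diagonal in column \<open>i\<close> vanishes.\<close>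
  have eig: "(\<Sum>j<n. A $$ (k, j) * p i j) = J $$ (i, i) * p i k"
    if "i < n" "k < n" and no: "\<And>j. Suc j = i \<Longrightarrow> J $$ (j, i) = 0" for i k
  proof -
    have "(\<Sum>j<n. p j k * J $$ (j, i)) = (\<Sum>j<n. if j = i then p j k * J $$ (j, i) else 0)"
    proof (rule sum.cong[OF refl])
      fix j assume "j \<in> {..<n}"
      then show "p j k * J $$ (j, i) = (if j = i then p j k * J $$ (j, i) else 0)"
        using Jent[of j i] no[of j] that(1) by auto
    qed
    then show ?thesis using step[OF that(1,2)] that(1) by simp
  qed
  \<comment> \<open>By strong induction \<open>p i\<close> is a true eigenvector, while a one at
    \<open>(i, Suc i)\<close> turns \<open>p (Suc i)\<close> into a generalized eigenvector above
    it.\<close>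
  have off: "J $$ (i, Suc i) = 0" if "Suc i < n" for i
    using that
  proof (induction i rule: less_induct)
    case (less i)
    show ?case
    proof (rule ccontr)
      assume nz: "J $$ (i, Suc i) \<noteq> 0"
      with less.prems Jent[of i "Suc i"] have one: "J $$ (i, Suc i) = 1"
        and eq: "J $$ (Suc i, Suc i) = J $$ (i, i)" by auto
      define c where "c = J $$ (i, i)"
      have e1: "(\<Sum>j<n. A $$ (k, j) * p i j) = c * p i k" if "k < n" for k
        unfolding c_def by (rule eig) (use less that in auto)
      have e2: "(\<Sum>j<n. A $$ (k, j) * p (Suc i) j) = c * p (Suc i) k + p i k" if "k < n" for k
      proof -
        have "(\<Sum>j<n. p j k * J $$ (j, Suc i))
            = (\<Sum>j<n. (if j = Suc i then c * p j k else 0) + (if j = i then p j k else 0))"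
        proof (rule sum.cong[OF refl])
          fix j assume "j \<in> {..<n}"
          then show "p j k * J $$ (j, Suc i)
              = (if j = Suc i then c * p j k else 0) + (if j = i then p j k else 0)"
            using Jent[of j "Suc i"] less.prems one eq unfolding c_def by auto
        qed
        then show ?thesis using step[of "Suc i" k] that less.prems by (simp add: sum.distrib)
      qed
      \<comment> \<open>The form at \<open>p i\<close> and \<open>p (Suc i)\<close> is computed with
        \<open>A\<close> acting on either argument; the two values differ by the squared norm of
        \<open>p i\<close>.\<close>
      let ?B = "\<Sum>k<n. \<Sum>j<n. p i k * A $$ (k, j) * p (Suc i) j"
      have "?B = (\<Sum>k<n. p i k * (c * p (Suc i) k + p i k))"
        by (intro sum.cong refl) (simp add: e2[symmetric] sum_distrib_left mult.assoc)
      moreover have "?B = (\<Sum>k<n. p (Suc i) k * (c * p i k))"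
      proof -
        have "?B = (\<Sum>k<n. \<Sum>j<n. p (Suc i) k * (A $$ (k, j) * p i j))"
          by (subst sum.swap) (intro sum.cong refl, simp add: sym mult_ac)
        also have "\<dots> = (\<Sum>k<n. p (Suc i) k * (c * p i k))"
          by (intro sum.cong refl) (simp add: e1[symmetric] sum_distrib_left)
        finally show ?thesis .
      qed
      ultimately have "(\<Sum>k<n. p i k * p i k) = 0"
        by (simp add: algebra_simps sum.distrib)
      then have z: "P $$ (k, i) = 0" if "k < n" for k
        using that unfolding p_def by (subst (asm) sum_nonneg_eq_0_iff) auto
      \<comment> \<open>A zero column of \<open>P\<close> contradicts its invertibility.\<close>
      have "(Q * P) $$ (i, i) = (\<Sum>k<n. Q $$ (i, k) * P $$ (k, i))"
        using P Q less.prems by (simp add: scalar_prod_def lessThan_atLeast0)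
      also have "\<dots> = 0" using z by simp
      finally show False unfolding QP using less.prems by simp
    qed
  qed
  show ?thesis
  proof (rule that[of "\<lambda>i. J $$ (i, i)" p "\<lambda>i j. Q $$ (i, j)"])
    have "upper_triangular J" using J jordan_matrix_upper_triangular[of _ n_as]
      unfolding J_def by (auto simp: upper_triangular_def)
    from char_poly_upper_triangular[OF J this] char_poly_similar[OF simi]
    show "char_poly A = (\<Prod>i\<leftarrow>[0..<n]. [:- J $$ (i, i), 1:])"
      using J by (simp add: diag_mat_def o_def)
    show "(\<Sum>j<n. A $$ (k, j) * p i j) = J $$ (i, i) * p i k" if "i < n" "k < n" for i k
      using that off by (intro eig) auto
    fix x :: "nat \<Rightarrow> real" and k assume k: "k < n"
    have "(\<Sum>i<n. (\<Sum>j<n. Q $$ (i, j) * x j) * p i k) = (\<Sum>j<n. (\<Sum>i<n. P $$ (k, i) * Q $$ (i, j)) * x j)"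
      unfolding sum_distrib_right p_def by (subst sum.swap) (simp add: mult_ac)
    also have "\<dots> = (\<Sum>j<n. (P * Q) $$ (k, j) * x j)"
      using P Q k by (intro sum.cong refl) (simp add: scalar_prod_def lessThan_atLeast0)
    also have "\<dots> = (\<Sum>j<n. if j = k then x j else 0)"
      unfolding PQ using k by (intro sum.cong refl) auto
    also have "\<dots> = x k" using k by simp
    finally show "(\<Sum>i<n. (\<Sum>j<n. Q $$ (i, j) * x j) * p i k) = x k" .
  qed
qed

section \<open>Counting eigenvalues with multiplicity\<close>

lemma order_prod_linear_factors:
  fixes e :: "nat \<Rightarrow> real"
  shows "order x (\<Prod>i\<leftarrow>[0..<n]. [:- e i, 1:]) = card {i. i < n \<and> e i = x}"
proof (induction n)
  case 0
  then show ?case by simp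
next
  case (Suc n)
  have "order x (\<Prod>i\<leftarrow>[0..<Suc n]. [:- e i, 1:])
      = order x ((\<Prod>i\<leftarrow>[0..<n]. [:- e i, 1:]) * [:- e n, 1:])" by simp
  also have "\<dots> = order x (\<Prod>i\<leftarrow>[0..<n]. [:- e i, 1:]) + order x [:- e n, 1:]"
    by (rule order_mult) (simp add: prod_list_zero_iff image_iff del: mult_pCons_left mult_pCons_right)
  also have "\<dots> = card {i. i < n \<and> e i = x} + (if e n = x then 1 else 0)"
    using Suc order_linear_power[of x "- e n" 1] by auto
  also have "\<dots> = card {i. i < Suc n \<and> e i = x}"
  proof (cases "e n = x")
    case True
    then have "{i. i < Suc n \<and> e i = x} = insert n {i. i < n \<and> e i = x}" by (auto simp: less_Suc_eq)
    then show ?thesis using True by simp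
  next
    case False
    then have "{i. i < Suc n \<and> e i = x} = {i. i < n \<and> e i = x}" by (auto simp: less_Suc_eq)
    then show ?thesis using False by simp
  qed
  finally show ?case .
qed

text \<open>Grouping the indices by the value of \<open>e\<close> turns multiplicities into a count
  of indices; \<open>R\<close> stands for any of the three sign conditions.\<close>

lemma sum_order_char_poly:
  fixes A :: "real mat" and e :: "nat \<Rightarrow> real"
  assumes A: "A \<in> carrier_mat n n" and cp: "char_poly A = (\<Prod>i\<leftarrow>[0..<n]. [:- e i, 1:])"
  shows "(\<Sum>x | eigenvalue A x \<and> R x. order x (char_poly A)) = card {i. i < n \<and> R (e i)}"
proof -
  let ?S = "{i. i < n \<and> R (e i)}"
  have "eigenvalue A x \<longleftrightarrow> x \<in> e ` {..<n}" for x
    unfolding eigenvalue_root_char_poly[OF A] cp poly_prod_list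
    by (auto simp: prod_list_zero_iff o_def image_iff)
  then have "{x. eigenvalue A x \<and> R x} = e ` ?S" by auto
  then have "(\<Sum>x | eigenvalue A x \<and> R x. order x (char_poly A)) = (\<Sum>x\<in>e ` ?S. card {i. i < n \<and> e i = x})"
    unfolding cp order_prod_linear_factors by simp
  also have "\<dots> = (\<Sum>x\<in>e ` ?S. card {i \<in> ?S. e i = x})"
    by (intro sum.cong refl arg_cong[where f = card]) auto
  also have "\<dots> = card ?S"
    using sum.image_gen[of ?S "\<lambda>_. 1 :: nat" e] by simp
  finally show ?thesis .
qed

section \<open>Isotropic coordinate subspaces and inertia\<close>

text \<open>Padding the equations with zero rows gives a singular square matrix, and a nonzero
  kernel vector of it is a solution.\<close>

lemma homogeneous_system_nontrivial_solution:
  fixes c :: "'i \<Rightarrow> nat \<Rightarrow> real"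
  assumes I: "finite I" "card I < n"
  obtains x k where "k < n" "x k \<noteq> 0" "\<And>i. i \<in> I \<Longrightarrow> (\<Sum>j<n. c i j * x j) = 0"
proof -
  obtain h where h: "bij_betw h {0..<card I} I" using ex_bij_betw_nat_finite[OF I(1)] by blast
  \<comment> \<open>Row \<open>card I\<close> is singled out as the zero vector to match
    \<open>det_row_0\<close>; the rows after it vanish too.\<close>
  define M where "M = mat\<^sub>r n n (\<lambda>i. if i = card I then 0\<^sub>v n else
    vec n (\<lambda>j. if i < card I then c (h i) j else 0))"
  have "det M = 0" unfolding M_def by (rule det_row_0[OF I(2)]) auto
  moreover have M: "M \<in> carrier_mat n n" unfolding M_def by simp
  ultimately obtain v where v: "v \<in> carrier_vec n" "v \<noteq> 0\<^sub>v n" "M *\<^sub>v v = 0\<^sub>v n"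
    using det_0_iff_vec_prod_zero by blast
  obtain k where k: "k < n" "v $ k \<noteq> 0" using v by (auto simp: vec_eq_iff)
  have "(\<Sum>j<n. c i j * v $ j) = 0" if "i \<in> I" for i
  proof -
    have "i \<in> h ` {0..<card I}" using that h by (simp add: bij_betw_imp_surj_on)
    then obtain m where m: "m < card I" "h m = i" by auto
    then have "m < n" using I(2) by simp
    have "(M *\<^sub>v v) $ m = (\<Sum>j<n. c i j * v $ j)"
      using m \<open>m < n\<close> v(1) unfolding M_def by (simp add: scalar_prod_def lessThan_atLeast0)
    then show ?thesis using v \<open>m < n\<close> by simp
  qed
  with k show thesis by (rule that[of k "\<lambda>j. v $ j"])
qed

text \<open>The coefficients \<open>z\<close> live on the eigenvectors whose eigenvalue has the wrong sign. Eigenvectors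
  for different eigenvalues being orthogonal, the form is \<open>- s\<close> times the squared norm of the vector
  with coefficients \<open>z i * sqrt \<bar>e i\<bar>\<close>.\<close>

lemma form_on_eigenvectors_sign:
  fixes a :: "nat \<Rightarrow> nat \<Rightarrow> real" and p :: "nat \<Rightarrow> nat \<Rightarrow> real"
  assumes sym: "\<And>i j. i < n \<Longrightarrow> j < n \<Longrightarrow> a i j = a j i"
    and eig: "\<And>i k. i < n \<Longrightarrow> k < n \<Longrightarrow> (\<Sum>j<n. a k j * p i j) = e i * p i k"
    and x: "\<And>k. k < n \<Longrightarrow> x k = (\<Sum>i<n. z i * p i k)"
    and s: "s = 1 \<or> s = - 1"
    and z: "\<And>i. i < n \<Longrightarrow> 0 < s * e i \<Longrightarrow> z i = 0"
  shows "s * (\<Sum>k<n. \<Sum>j<n. x k * a k j * x j) \<le> 0"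
proof -
  \<comment> \<open>This is the Gram matrix of the eigenvectors, which need not be orthogonal within
    one eigenspace.\<close>
  define g where "g i j = (\<Sum>k<n. p i k * p j k)" for i j
  have orth: "e i * g i j = e j * g i j" if "i < n" "j < n" for i j
  proof -
    have "e j * g i j = (\<Sum>k<n. \<Sum>l<n. p i k * a k l * p j l)"
      unfolding g_def sum_distrib_left
    proof (intro sum.cong refl)
      fix k assume "k \<in> {..<n}"
      then have "e j * (p i k * p j k) = p i k * (\<Sum>l<n. a k l * p j l)" using eig[OF that(2)] by simp
      then show "e j * (p i k * p j k) = (\<Sum>l<n. p i k * a k l * p j l)"
        by (simp add: sum_distrib_left mult.assoc)
    qed
    also have "\<dots> = (\<Sum>k<n. \<Sum>l<n. p j k * (a k l * p i l))"
      by (subst sum.swap) (intro sum.cong refl, simp add: sym mult_ac)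
    also have "\<dots> = e i * g i j"
      unfolding g_def sum_distrib_left
      by (intro sum.cong refl) (simp add: eig[OF that(1), symmetric] sum_distrib_left[symmetric])
    finally show ?thesis by (rule HOL.sym)
  qed
  have ax: "(\<Sum>j<n. a k j * x j) = (\<Sum>i<n. z i * e i * p i k)" if "k < n" for k
  proof -
    have "(\<Sum>j<n. a k j * x j) = (\<Sum>j<n. \<Sum>i<n. z i * (a k j * p i j))"
      by (intro sum.cong refl) (simp add: x sum_distrib_left mult_ac)
    also have "\<dots> = (\<Sum>i<n. z i * (\<Sum>j<n. a k j * p i j))"
      by (subst sum.swap) (simp add: sum_distrib_left)
    also have "\<dots> = (\<Sum>i<n. z i * e i * p i k)"
      using that by (intro sum.cong refl) (simp add: eig)
    finally show ?thesis .
  qed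
  have expand: "(\<Sum>k<n. (\<Sum>i<n. u i * p i k) * (\<Sum>i<n. v i * p i k)) = (\<Sum>i<n. \<Sum>j<n. u i * v j * g i j)"
    for u v
  proof -
    have "(\<Sum>k<n. (\<Sum>i<n. u i * p i k) * (\<Sum>i<n. v i * p i k))
        = (\<Sum>k<n. \<Sum>i<n. \<Sum>j<n. u i * v j * (p i k * p j k))"
      by (simp add: sum_product mult_ac)
    also have "\<dots> = (\<Sum>i<n. \<Sum>k<n. \<Sum>j<n. u i * v j * (p i k * p j k))" by (rule sum.swap)
    also have "\<dots> = (\<Sum>i<n. \<Sum>j<n. u i * v j * g i j)"
      unfolding g_def sum_distrib_left by (rule sum.cong[OF refl], rule sum.swap)
    finally show ?thesis .
  qed
  define y where "y i = z i * sqrt \<bar>e i\<bar>" for i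
  have "s * (\<Sum>k<n. \<Sum>j<n. x k * a k j * x j) = s * (\<Sum>k<n. x k * (\<Sum>j<n. a k j * x j))"
    by (simp add: sum_distrib_left mult.assoc)
  also have "\<dots> = s * (\<Sum>k<n. x k * (\<Sum>i<n. (z i * e i) * p i k))" by (simp add: ax)
  also have "\<dots> = s * (\<Sum>k<n. (\<Sum>i<n. z i * p i k) * (\<Sum>i<n. (z i * e i) * p i k))"
    by (simp add: x)
  also have "\<dots> = (\<Sum>i<n. \<Sum>j<n. s * (z i * (z j * e j) * g i j))"
    unfolding expand by (simp add: sum_distrib_left)
  also have "\<dots> = (\<Sum>i<n. \<Sum>j<n. - (y i * y j * g i j))"
  proof (intro sum.cong refl)
    fix i j assume ij: "i \<in> {..<n}" "j \<in> {..<n}"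
    show "s * (z i * (z j * e j) * g i j) = - (y i * y j * g i j)"
    proof (cases "g i j = 0 \<or> z j = 0")
      case True
      then show ?thesis by (auto simp: y_def)
    next
      case False
      \<comment> \<open>Where \<open>g i j\<close> is nonzero the two eigenvalues agree, so the
        square roots in \<open>y i\<close> and \<open>y j\<close> multiply to
        \<open>- s * e j\<close>.\<close>
      then have "e i = e j" using orth[of i j] ij by simp
      moreover have "s * e j \<le> 0" using z[of j] ij False by force
      then have "\<bar>e j\<bar> = - s * e j" using s by (auto simp: abs_if)
      then have "sqrt \<bar>e j\<bar> * sqrt \<bar>e j\<bar> = - s * e j" by simp
      ultimately show ?thesis by (simp add: y_def mult_ac)
    qed
  qed
  also have "\<dots> = - (\<Sum>k<n. (\<Sum>i<n. y i * p i k) * (\<Sum>i<n. y i * p i k))"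
    unfolding expand by (simp add: sum_negf)
  also have "\<dots> \<le> 0" by (simp add: sum_nonneg)
  finally show ?thesis .
qed

text \<open>With too few eigenvalues of sign \<open>s\<close>, some nonzero \<open>x\<close> has no
  component along their eigenvectors and also satisfies \<open>n - card V\<close> chosen
  constraints. The first property makes \<open>s\<close> times the form nonpositive, the second
  makes it twice the squared norm of \<open>x\<close> on \<open>U\<close>. So \<open>x\<close>
  vanishes on \<open>U\<close>, and injectivity of the block with rows \<open>U\<close> and columns
  \<open>V\<close> kills the rest.\<close>

lemma isotropic_card_le_eigenvalues:
  fixes a :: "nat \<Rightarrow> nat \<Rightarrow> real" and p r :: "nat \<Rightarrow> nat \<Rightarrow> real"
  assumes sym: "\<And>i j. i < n \<Longrightarrow> j < n \<Longrightarrow> a i j = a j i"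
    and eig: "\<And>i k. i < n \<Longrightarrow> k < n \<Longrightarrow> (\<Sum>j<n. a k j * p i j) = e i * p i k"
    and r: "\<And>x k. k < n \<Longrightarrow> (\<Sum>i<n. (\<Sum>j<n. r i j * x j) * p i k) = x k"
    and s: "s = 1 \<or> s = - 1"
    and UV: "U \<subseteq> {..<n}" "V \<subseteq> {..<n}" "U \<inter> V = {}"
    and iso: "\<And>i j. i \<in> V \<Longrightarrow> j \<in> V \<Longrightarrow> a i j = 0"
    and inj: "\<And>x v. (\<And>u. u \<in> U \<Longrightarrow> (\<Sum>v\<in>V. a u v * x v) = 0) \<Longrightarrow> v \<in> V \<Longrightarrow> x v = 0"
  shows "card V \<le> card {i. i < n \<and> 0 < s * e i}"
proof (rule ccontr)
  assume few: "\<not> ?thesis"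
  define N where "N = {i. i < n \<and> 0 < s * e i}"
  have less: "card N < card V" unfolding N_def using few by simp
  have fin: "finite U" "finite V" using UV finite_subset by blast+
  \<comment> \<open>The left summand removes the eigenvector coordinates of sign \<open>s\<close>;
    the right one has one constraint for each index outside \<open>V\<close>. As
    \<open>card N < card V\<close>, these are fewer than \<open>n\<close> equations.\<close>
  let ?I = "N <+> ({..<n} - V)"
  \<comment> \<open>The last constraints make the form equal to \<open>2 s (\<Sum>u\<in>U. (x u)\<^sup>2)\<close>.\<close>
  define c where "c = case_sum r (\<lambda>k j.
    if k \<in> U then (if j \<in> U then a k j / 2 else 0) + (if j \<in> V then a k j else 0) - (if j = k then s else 0)
    else if j = k then 1 else 0)"
  have "card ({..<n} - V) = n - card V" using UV fin by (simp add: card_Diff_subset)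
  moreover have "card V \<le> n" using UV card_mono[of "{..<n}" V] by simp
  ultimately have "card ?I < n" using less by (subst card_Plus) (auto simp: N_def)
  moreover have "finite ?I" by (auto simp: N_def)
  ultimately obtain x k where k: "k < n" "x k \<noteq> 0" and x: "\<And>i. i \<in> ?I \<Longrightarrow> (\<Sum>j<n. c i j * x j) = 0"
    using homogeneous_system_nontrivial_solution[of ?I n c] by blast
  have cU: "(\<Sum>j\<in>U. a u j * x j) / 2 + (\<Sum>j\<in>V. a u j * x j) = s * x u" if "u \<in> U" for u
  proof -
    have u: "u < n" "u \<notin> V" using that UV by auto
    have "(\<Sum>j<n. c (Inr u) j * x j) = (\<Sum>j<n. (if j \<in> U then a u j * x j / 2 else 0)
        + (if j \<in> V then a u j * x j else 0) - (if j = u then s * x j else 0))"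
      unfolding c_def using that by (intro sum.cong refl) (simp add: algebra_simps)
    also have "\<dots> = (\<Sum>j\<in>U. a u j * x j / 2) + (\<Sum>j\<in>V. a u j * x j) - s * x u"
      using UV u by (simp add: sum.distrib sum_subtractf sum.inter_restrict[symmetric] Int_absorb1)
    also have "(\<Sum>j\<in>U. a u j * x j / 2) = (\<Sum>j\<in>U. a u j * x j) / 2" by (simp add: sum_divide_distrib)
    finally show ?thesis using x[OF InrI, of u] u by simp
  qed
  have c0: "x j = 0" if "j < n" "j \<notin> U" "j \<notin> V" for j
  proof -
    have "(\<Sum>l<n. c (Inr j) l * x l) = (\<Sum>l<n. if l = j then x l else 0)"
      unfolding c_def using that by (intro sum.cong refl) auto
    then show ?thesis using x[OF InrI, of j] that by simp
  qed
  have restr: "(\<Sum>j<n. f j * x j) = (\<Sum>j\<in>U. f j * x j) + (\<Sum>j\<in>V. f j * x j)" for f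
  proof -
    have "(\<Sum>j<n. f j * x j) = (\<Sum>j\<in>U \<union> V. f j * x j)"
      using UV c0 by (intro sum.mono_neutral_right) auto
    then show ?thesis using UV fin by (simp add: sum.union_disjoint)
  qed
  have "(\<Sum>k<n. \<Sum>j<n. x k * a k j * x j) = (\<Sum>k<n. (\<Sum>j<n. a k j * x j) * x k)"
    by (simp add: sum_distrib_left sum_distrib_right mult_ac)
  also have "\<dots> = (\<Sum>u\<in>U. ((\<Sum>j\<in>U. a u j * x j) + (\<Sum>j\<in>V. a u j * x j)) * x u)
      + (\<Sum>v\<in>V. (\<Sum>j\<in>U. a v j * x j) * x v)"
    unfolding restr using iso by simp
  also have "(\<Sum>v\<in>V. (\<Sum>j\<in>U. a v j * x j) * x v) = (\<Sum>u\<in>U. (\<Sum>v\<in>V. a u v * x v) * x u)"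
  proof -
    have "(\<Sum>v\<in>V. (\<Sum>j\<in>U. a v j * x j) * x v) = (\<Sum>v\<in>V. \<Sum>u\<in>U. a u v * x v * x u)"
      unfolding sum_distrib_right
    proof (intro sum.cong refl)
      fix v u assume "v \<in> V" "u \<in> U"
      then show "a v u * x u * x v = a u v * x v * x u"
        using sym[of v u] UV by (auto simp: subset_iff)
    qed
    also have "\<dots> = (\<Sum>u\<in>U. (\<Sum>v\<in>V. a u v * x v) * x u)"
      unfolding sum_distrib_right by (rule sum.swap)
    finally show ?thesis .
  qed
  \<comment> \<open>The block on \<open>V\<close> contributes nothing and the two mixed blocks agree
    by symmetry. The form is therefore twice the left side of \<open>cU\<close> paired with
    \<open>x\<close>, which explains the factor one half there.\<close>
  also have "(\<Sum>u\<in>U. ((\<Sum>j\<in>U. a u j * x j) + (\<Sum>j\<in>V. a u j * x j)) * x u)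
      + (\<Sum>u\<in>U. (\<Sum>v\<in>V. a u v * x v) * x u) = (\<Sum>u\<in>U. 2 * s * (x u * x u))"
    unfolding sum.distrib[symmetric]
  proof (intro sum.cong refl)
    fix u assume "u \<in> U"
    have "((\<Sum>j\<in>U. a u j * x j) + (\<Sum>j\<in>V. a u j * x j)) * x u + (\<Sum>v\<in>V. a u v * x v) * x u
        = 2 * ((\<Sum>j\<in>U. a u j * x j) / 2 + (\<Sum>j\<in>V. a u j * x j)) * x u"
      by (simp add: field_simps)
    then show "((\<Sum>j\<in>U. a u j * x j) + (\<Sum>j\<in>V. a u j * x j)) * x u + (\<Sum>v\<in>V. a u v * x v) * x u
        = 2 * s * (x u * x u)"
      unfolding cU[OF \<open>u \<in> U\<close>] by simp
  qed
  also have "\<dots> = 2 * s * (\<Sum>u\<in>U. x u * x u)" by (simp add: sum_distrib_left)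
  finally have form: "s * (\<Sum>k<n. \<Sum>j<n. x k * a k j * x j) = 2 * (\<Sum>u\<in>U. x u * x u)"
    using s by auto
  have "s * (\<Sum>k<n. \<Sum>j<n. x k * a k j * x j) \<le> 0"
  proof (rule form_on_eigenvectors_sign[OF sym eig _ s])
    show "x k = (\<Sum>i<n. (\<Sum>j<n. r i j * x j) * p i k)" if "k < n" for k
      using r[OF that] by simp
    show "(\<Sum>j<n. r i j * x j) = 0" if "i < n" "0 < s * e i" for i
      using x[OF InlI, of i] that by (simp add: c_def N_def)
  qed
  moreover have "0 \<le> (\<Sum>u\<in>U. x u * x u)" by (simp add: sum_nonneg)
  ultimately have "(\<Sum>u\<in>U. x u * x u) = 0" using form by simp
  then have xU: "x u = 0" if "u \<in> U" for u
    using that fin by (subst (asm) sum_nonneg_eq_0_iff) auto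
  \<comment> \<open>For \<open>x\<close> vanishing on \<open>U\<close>, the constraint
    \<open>cU\<close> reduces to the equation to which \<open>inj\<close> applies.\<close>
  have "(\<Sum>v\<in>V. a u v * x v) = 0" if "u \<in> U" for u
    using cU[OF that] xU that by simp
  then have "x v = 0" if "v \<in> V" for v using inj that by blast
  with xU c0 k show False by blast
qed

text \<open>The previous bound is used for both signs. The indices split into positive, negative and
  zero eigenvalues, which bounds the nullity.\<close>

lemma symmetric_inertia_ge:
  fixes A :: "real mat"
  assumes A: "A \<in> carrier_mat n n"
    and sym: "\<And>i j. i < n \<Longrightarrow> j < n \<Longrightarrow> A $$ (i, j) = A $$ (j, i)"
    and UV: "U \<subseteq> {..<n}" "V \<subseteq> {..<n}" "U \<inter> V = {}"
    and iso: "\<And>i j. i \<in> V \<Longrightarrow> j \<in> V \<Longrightarrow> A $$ (i, j) = 0"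
    and inj: "\<And>x v. (\<And>u. u \<in> U \<Longrightarrow> (\<Sum>v\<in>V. A $$ (u, v) * x v) = 0) \<Longrightarrow> v \<in> V \<Longrightarrow> x v = 0"
  shows "card V \<le> i_pos A \<and> card V \<le> i_neg A \<and> i_zero A + 2 * card V \<le> n"
proof -
  obtain e :: "nat \<Rightarrow> real" and p r :: "nat \<Rightarrow> nat \<Rightarrow> real"
    where cp: "char_poly A = (\<Prod>i\<leftarrow>[0..<n]. [:- e i, 1:])"
    and eig: "\<And>i k. i < n \<Longrightarrow> k < n \<Longrightarrow> (\<Sum>j<n. A $$ (k, j) * p i j) = e i * p i k"
    and r: "\<And>x k. k < n \<Longrightarrow> (\<Sum>i<n. (\<Sum>j<n. r i j * x j) * p i k) = x k"
    using symmetric_eigenbasis[OF A sym] by blast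
  have le: "card V \<le> card {i. i < n \<and> 0 < s * e i}" if "s = 1 \<or> s = - 1" for s
    using sym eig r that UV iso inj
    by (rule isotropic_card_le_eigenvalues[where n = n and a = "\<lambda>i j. A $$ (i, j)" and p = p
          and e = e and r = r and s = s and U = U and V = V])
  have pos: "i_pos A = card {i. i < n \<and> 0 < e i}"
    unfolding i_pos_def by (rule sum_order_char_poly[OF A cp])
  have neg: "i_neg A = card {i. i < n \<and> e i < 0}"
    unfolding i_neg_def by (rule sum_order_char_poly[OF A cp])
  have zero: "i_zero A = card {i. i < n \<and> e i = 0}"
    unfolding i_zero_def by (rule sum_order_char_poly[OF A cp])
  have gepos: "card V \<le> i_pos A" using le[of 1] unfolding pos by simp
  have geneg: "card V \<le> i_neg A" using le[of "- 1"] unfolding neg by simp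
  have "{..<n} = {i. i < n \<and> e i = 0} \<union> ({i. i < n \<and> 0 < e i} \<union> {i. i < n \<and> e i < 0})" by auto
  then have "n = card ({i. i < n \<and> e i = 0} \<union> ({i. i < n \<and> 0 < e i} \<union> {i. i < n \<and> e i < 0}))"
    by (metis card_lessThan)
  also have "\<dots> = i_zero A + card ({i. i < n \<and> 0 < e i} \<union> {i. i < n \<and> e i < 0})"
    unfolding zero by (rule card_Un_disjoint) auto
  also have "card ({i. i < n \<and> 0 < e i} \<union> {i. i < n \<and> e i < 0}) = i_pos A + i_neg A"
    unfolding pos neg by (rule card_Un_disjoint) auto
  finally show ?thesis using gepos geneg by simp
qed

section \<open>Infinity graphs\<close>

lemma finite_edges: "pair_graph G \<Longrightarrow> finite (edges G)"
  unfolding edges_def pair_graph_def pair_digraph_def pair_fin_digraph_def pair_fin_digraph_axioms_def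
  by auto

lemma pair_graph_sym: "pair_graph G \<Longrightarrow> (u, v) \<in> parcs G \<Longrightarrow> (v, u) \<in> parcs G"
  using pair_sym_digraph.pair_sym_arcs[of G] pair_graph.axioms(2)[of G] pair_pseudo_graph.axioms(2)[of G]
  by (auto simp: symmetric_def sym_def)

lemma pair_graph_wf: "pair_graph G \<Longrightarrow> (u, v) \<in> parcs G \<Longrightarrow> u \<in> pverts G \<and> v \<in> pverts G"
  using pair_wf_digraph.wellformed'[of G] pair_graph.axioms(1)[of G] pair_digraph.axioms(1)[of G]
    pair_fin_digraph.axioms(1)[of G] by blast

lemma pair_graph_irrefl: "pair_graph G \<Longrightarrow> (u, u) \<notin> parcs G"
  using pair_loopfree_digraph.pair_no_loops[of G "(u, u)"] pair_graph.axioms(1)[of G] pair_digraph.axioms(2)[of G]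
  by auto

lemma doubleton_in_edges_iff: "pair_graph G \<Longrightarrow> {u, v} \<in> edges G \<longleftrightarrow> (u, v) \<in> parcs G"
  unfolding edges_def by (auto simp: doubleton_eq_iff image_iff dest: pair_graph_sym)

text \<open>Each vertex outside \<open>S\<close> is charged to an edge towards a vertex that is strictly closer to \<open>S\<close>.\<close>

lemma connected_card_edges_outside:
  assumes G: "pair_graph G" and con: "connected (with_proj G)"
    and S: "S \<subseteq> pverts G" "S \<noteq> {}"
  shows "card (pverts G - S) \<le> card {e \<in> edges G. \<not> e \<subseteq> S}"
proof -
  obtain s where s: "s \<in> S" using S by blast
  \<comment> \<open>The distance of \<open>v\<close> from \<open>S\<close>; connectedness guarantees
    that the minimum is attained.\<close>
  define d where "d v = (LEAST k. \<exists>t\<in>S. (t, v) \<in> parcs G ^^ k)" for v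
  \<comment> \<open>Connectedness is defined through the symmetric closure, which adds no arcs
    here.\<close>
  have arcs: "parcs (mk_symmetric (with_proj G)) = parcs G"
    using pair_graph_sym[OF G] by (force simp: parcs_mk_symmetric)
  have "\<exists>u. (u, v) \<in> parcs G \<and> d u < d v" if v: "v \<in> pverts G - S" for v
  proof -
    have "s \<rightarrow>\<^sup>*\<^bsub>with_proj (mk_symmetric (with_proj G))\<^esub> v"
      using con s S v unfolding connected_def strongly_connected_def by auto
    then have "(s, v) \<in> (parcs G)\<^sup>*" using reachable_rtranclI arcs by fastforce
    then obtain k where "(s, v) \<in> parcs G ^^ k" using rtrancl_power by blast
    then have "\<exists>k. \<exists>t\<in>S. (t, v) \<in> parcs G ^^ k" using s by blast
    then have "\<exists>t\<in>S. (t, v) \<in> parcs G ^^ d v" unfolding d_def by (rule LeastI_ex)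
    then obtain t where t: "t \<in> S" "(t, v) \<in> parcs G ^^ d v" by blast
    \<comment> \<open>A vertex outside \<open>S\<close> has positive distance, and its predecessor
      on a shortest walk is strictly closer.\<close>
    then have "d v \<noteq> 0" using v by (cases "d v") auto
    then obtain m where m: "d v = Suc m" by (cases "d v") auto
    with t obtain u where u: "(t, u) \<in> parcs G ^^ m" "(u, v) \<in> parcs G" by auto
    have "d u \<le> m" unfolding d_def by (rule Least_le) (use t u in blast)
    then show ?thesis using u m by auto
  qed
  then obtain f where f: "\<And>v. v \<in> pverts G - S \<Longrightarrow> (f v, v) \<in> parcs G \<and> d (f v) < d v"
    by metis
  have "inj_on (\<lambda>v. {f v, v}) (pverts G - S)"
  proof (rule inj_onI)
    fix u v assume u: "u \<in> pverts G - S" and v: "v \<in> pverts G - S" and eq: "{f u, u} = {f v, v}"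
    \<comment> \<open>In the crossed case each of \<open>u\<close> and \<open>v\<close> would be
      strictly closer to \<open>S\<close> than the other.\<close>
    from eq consider "u = v" | "f u = v" "u = f v" by (auto simp: doubleton_eq_iff)
    then show "u = v" using f[OF u] f[OF v] by cases auto
  qed
  moreover have "(\<lambda>v. {f v, v}) ` (pverts G - S) \<subseteq> {e \<in> edges G. \<not> e \<subseteq> S}"
    using f doubleton_in_edges_iff[OF G] by auto
  ultimately show ?thesis
    by (rule card_inj_on_le) (simp add: finite_edges[OF G])
qed

text \<open>Both graphs have one edge more than vertices. Each vertex outside \<open>H\<close>
  accounts for an edge of \<open>G\<close> not inside \<open>pverts H\<close>, so at most
  \<open>card (edges H)\<close> edges of \<open>G\<close> lie inside; these include
  \<open>edges H\<close>, hence coincide with it.\<close>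

lemma base_arcs_induced:
  assumes G: "bicyclic G" and H: "is_base H G"
    and uv: "(u, v) \<in> parcs G" "u \<in> pverts H" "v \<in> pverts H"
  shows "(u, v) \<in> parcs H"
proof -
  have pg: "pair_graph G" "connected (with_proj G)" "card (edges G) = card (pverts G) + 1"
    using G by (auto simp: bicyclic_def)
  have ph: "pair_graph H" "card (edges H) = card (pverts H) + 1"
    and sub: "pverts H \<subseteq> pverts G" "parcs H \<subseteq> parcs G"
    using H by (auto simp: is_base_def bicyclic_def subgraph_def)
  let ?S = "pverts H"
  let ?in = "{e \<in> edges G. e \<subseteq> ?S}" and ?out = "{e \<in> edges G. \<not> e \<subseteq> ?S}"
  have fin: "finite (pverts G)"
    using pg(1) unfolding pair_graph_def pair_digraph_def pair_fin_digraph_def pair_fin_digraph_axioms_def by auto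
  have fe: "finite (edges G)" by (rule finite_edges[OF pg(1)])
  have "card (pverts G - ?S) \<le> card ?out"
    by (rule connected_card_edges_outside) (use pg sub uv in auto)
  moreover have "card (pverts G - ?S) = card (pverts G) - card ?S"
    using sub fin by (simp add: card_Diff_subset finite_subset)
  moreover have "card ?S \<le> card (pverts G)" using sub fin by (simp add: card_mono)
  moreover have "card (edges G) = card ?in + card ?out"
    using fe by (subst card_Un_disjoint[symmetric]) (auto intro: arg_cong[where f = card])
  ultimately have le: "card ?in \<le> card (edges H)" using pg ph by simp
  have "edges H \<subseteq> ?in"
    using sub pair_graph_wf[OF ph(1)] by (fastforce simp: edges_def)
  moreover have "finite ?in" using fe by simp
  ultimately have "edges H = ?in" using card_seteq le by blast
  moreover have "{u, v} \<in> ?in" using uv doubleton_in_edges_iff[OF pg(1)] by simp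
  ultimately show ?thesis using doubleton_in_edges_iff[OF ph(1)] by blast
qed

section \<open>Edges of the two cycles that avoid given vertices\<close>

lemma cycle_arcsI:
  assumes "i < length cs"
  shows "(cs ! i, cs ! (Suc i mod length cs)) \<in> cycle_arcs cs" "(cs ! (Suc i mod length cs), cs ! i) \<in> cycle_arcs cs"
  using assms unfolding cycle_arcs_def by auto

lemma cycle_arcs_set: "(u, v) \<in> cycle_arcs cs \<Longrightarrow> u \<in> set cs \<and> v \<in> set cs"
  unfolding cycle_arcs_def by (auto intro!: nth_mem mod_less_divisor)

lemma path_arcs_set: "(u, v) \<in> path_arcs vs \<Longrightarrow> u \<in> set vs \<and> v \<in> set vs"
  unfolding path_arcs_def by auto

text \<open>The next two vertices after \<open>c\<close> along the cycle are consecutive, and both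
  differ from \<open>c\<close> because the length is at least three.\<close>

lemma cycle_arc_avoiding_vertex:
  assumes cs: "distinct cs" "3 \<le> length cs" and c: "c \<in> set cs"
  obtains u v where "(u, v) \<in> cycle_arcs cs" "u \<noteq> c" "v \<noteq> c"
proof -
  let ?p = "length cs"
  obtain i where i: "i < ?p" "cs ! i = c" using c by (auto simp: in_set_conv_nth)
  have lt: "Suc i mod ?p < ?p" "Suc (Suc i mod ?p) mod ?p < ?p"
    using cs by (auto intro!: mod_less_divisor)
  have "Suc i mod ?p \<noteq> i" "Suc (Suc i mod ?p) mod ?p \<noteq> i"
    using i cs by (auto simp: mod_Suc)
  then show thesis
    using that[OF cycle_arcsI(1)[OF lt(1)]] lt i cs by (metis nth_eq_iff_index_eq)
qed

text \<open>The predecessor and successor of \<open>c\<close> are distinct in a cycle of length at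
  least three, so one of them is not \<open>a\<close>.\<close>

lemma cycle_neighbour_avoiding_vertex:
  assumes cs: "distinct cs" "3 \<le> length cs" and c: "c \<in> set cs"
  obtains u where "(u, c) \<in> cycle_arcs cs" "u \<noteq> a"
proof -
  let ?p = "length cs"
  obtain i where i: "i < ?p" "cs ! i = c" using c by (auto simp: in_set_conv_nth)
  \<comment> \<open>The cyclic predecessor of \<open>i\<close>, wrapping around at zero.\<close>
  define j where "j = (if i = 0 then ?p - 1 else i - 1)"
  have j: "j < ?p" "Suc j mod ?p = i" using i cs by (auto simp: j_def)
  have lt: "Suc i mod ?p < ?p" using cs by (auto intro!: mod_less_divisor)
  have "Suc i mod ?p \<noteq> j" using i cs by (auto simp: j_def mod_Suc)
  then have "cs ! (Suc i mod ?p) \<noteq> cs ! j" using lt j cs by (simp add: nth_eq_iff_index_eq)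
  then consider "cs ! (Suc i mod ?p) \<noteq> a" | "cs ! j \<noteq> a" by metis
  then show thesis
  proof cases
    case 1
    then show thesis using that cycle_arcsI(2)[OF i(1)] i by blast
  next
    case 2
    then show thesis using that cycle_arcsI(1)[OF j(1)] j i by metis
  qed
qed

text \<open>Here \<open>c\<close> and \<open>d\<close> are the attachment vertices, and
  \<open>closed\<close> says that the base leaves \<open>ds\<close> only at \<open>d\<close>. An
  edge of \<open>cs\<close> missing \<open>c\<close> also misses \<open>a\<close>. Only
  \<open>v2\<close> has to be nonadjacent to the other edge; \<open>u2\<close> is
  unrestricted.\<close>

lemma two_cycles_half_induced_matching:
  assumes G: "bicyclic G" and H: "is_base H G"
    and cs: "distinct cs" "3 \<le> length cs" "c \<in> set cs"
    and ds: "distinct ds" "3 \<le> length ds"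
    and meet: "set cs \<inter> set ds \<subseteq> {c}"
    and arcs: "cycle_arcs cs \<subseteq> parcs H" "cycle_arcs ds \<subseteq> parcs H"
    and closed: "\<And>x y. (x, y) \<in> parcs H \<Longrightarrow> x \<in> set ds \<Longrightarrow> x \<noteq> d \<Longrightarrow> y \<in> set ds"
    and a: "a \<notin> set cs - {c}"
  obtains u2 v2 u3 v3 where "(u2, v2) \<in> parcs G" "(u3, v3) \<in> parcs G"
    "(v2, u3) \<notin> parcs G" "(v2, v3) \<notin> parcs G"
    "a \<notin> {u2, v2, u3, v3}" "{u2, v2} \<inter> {u3, v3} = {}"
proof -
  have sub: "parcs H \<subseteq> parcs G" and ph: "pair_graph H"
    using H by (auto simp: is_base_def bicyclic_def subgraph_def)
  obtain u3 v3 where e3: "(u3, v3) \<in> cycle_arcs cs" "u3 \<noteq> c" "v3 \<noteq> c"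
    using cycle_arc_avoiding_vertex[OF cs] by metis
  have mem3: "u3 \<in> set cs" "v3 \<in> set cs" using cycle_arcs_set[OF e3(1)] by auto
  then have out3: "u3 \<notin> set ds" "v3 \<notin> set ds" using meet e3 by auto
  \<comment> \<open>Three vertices on \<open>ds\<close> leave one different from both
    \<open>d\<close> and \<open>a\<close>.\<close>
  have "card {d, a} < card (set ds)"
    using ds card_insert_le_m1[of 2 "{a}" d] by (simp add: distinct_card)
  then have "\<not> set ds \<subseteq> {d, a}" using card_mono[of "{d, a}" "set ds"] by auto
  then obtain v2 where v2: "v2 \<in> set ds" "v2 \<noteq> d" "v2 \<noteq> a" by blast
  obtain u2 where u2: "(u2, v2) \<in> cycle_arcs ds" "u2 \<noteq> a"
    using cycle_neighbour_avoiding_vertex[OF ds v2(1)] by metis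
  have mem2: "u2 \<in> set ds" using cycle_arcs_set[OF u2(1)] by auto
  have verts: "v2 \<in> pverts H" "u3 \<in> pverts H" "v3 \<in> pverts H"
    using u2(1) e3(1) arcs pair_graph_wf[OF ph] by blast+
  \<comment> \<open>An arc of \<open>G\<close> between base vertices is an arc of the base, and
    those starting at \<open>v2\<close> stay on \<open>ds\<close>.\<close>
  have no: "(v2, y) \<notin> parcs G" if "y \<in> pverts H" "y \<notin> set ds" for y
    using base_arcs_induced[OF G H _ verts(1) that(1)] closed[of v2 y] v2 that(2) by blast
  show thesis
  proof (rule that)
    show "(u2, v2) \<in> parcs G" "(u3, v3) \<in> parcs G" using u2 e3 arcs sub by auto
    show "(v2, u3) \<notin> parcs G" "(v2, v3) \<notin> parcs G" using no verts out3 by auto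
    show "a \<notin> {u2, v2, u3, v3}" using u2 v2 e3 mem3 a by auto
    show "{u2, v2} \<inter> {u3, v3} = {}" using v2 mem2 out3 by auto
  qed
qed

text \<open>The arbitrary vertex \<open>a\<close> lies on at most one cycle minus its attachment
  vertex. The other cycle takes the role of \<open>cs\<close>, which is why all facts are prepared
  in both orders.\<close>

lemma infinity_graph_half_induced_matching:
  assumes "infinity_graph G"
  obtains u2 v2 u3 v3 where "(u2, v2) \<in> parcs G" "(u3, v3) \<in> parcs G"
    "(v2, u3) \<notin> parcs G" "(v2, v3) \<notin> parcs G"
    "a \<notin> {u2, v2, u3, v3}" "{u2, v2} \<inter> {u3, v3} = {}"
proof -
  obtain H p l q where G: "bicyclic G" and H: "is_base H G"
    and pq: "3 \<le> p" "3 \<le> q" and inf: "is_infinity p l q H"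
    using assms by (auto simp: infinity_graph_def)
  from inf obtain cs vs ds where cs': "distinct cs" "length cs = p" and ds': "distinct ds" "length ds = q"
    and cv: "set cs \<inter> set vs = {hd vs}" and dv: "set ds \<inter> set vs = {last vs}"
    and cd: "set cs \<inter> set ds \<subseteq> set vs"
    and arcs: "parcs H = cycle_arcs cs \<union> path_arcs vs \<union> cycle_arcs ds"
    unfolding is_infinity_def by (elim exE conjE) (rule that, assumption+)
  have cs: "distinct cs" "3 \<le> length cs" and ds: "distinct ds" "3 \<le> length ds"
    using cs' ds' pq by auto
  have c: "hd vs \<in> set cs" and d: "last vs \<in> set ds" using cv dv by auto
  have meet: "set cs \<inter> set ds \<subseteq> {hd vs}" "set ds \<inter> set cs \<subseteq> {last vs}" using cd cv dv by auto
  \<comment> \<open>Apart from \<open>last vs\<close>, no vertex of \<open>ds\<close> lies on the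
    path or on the other cycle.\<close>
  have closed_ds: "y \<in> set ds" if "(x, y) \<in> parcs H" "x \<in> set ds" "x \<noteq> last vs" for x y
    using that cycle_arcs_set[of x y cs] path_arcs_set[of x y vs] cycle_arcs_set[of x y ds] meet dv
    unfolding arcs by blast
  have closed_cs: "y \<in> set cs" if "(x, y) \<in> parcs H" "x \<in> set cs" "x \<noteq> hd vs" for x y
    using that cycle_arcs_set[of x y cs] path_arcs_set[of x y vs] cycle_arcs_set[of x y ds] meet cv
    unfolding arcs by blast
  have sub: "cycle_arcs cs \<subseteq> parcs H" "cycle_arcs ds \<subseteq> parcs H" unfolding arcs by auto
  show thesis
  proof (cases "a \<in> set cs - {hd vs}")
    case False
    show thesis
      by (rule two_cycles_half_induced_matching[OF G H cs c ds meet(1) sub closed_ds False that])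
  next
    case True
    then have other: "a \<notin> set ds - {last vs}" using meet by auto
    show thesis
      by (rule two_cycles_half_induced_matching[OF G H ds d cs meet(2) sub(2,1) closed_cs other that])
  qed
qed

section \<open>The triangular block at a pendant vertex\<close>

theorem theorem3p3:
  fixes G :: "'a pair_pre_digraph" and w :: "'a set \<Rightarrow> real" and xs :: "'a list" and n :: nat
  assumes "weighted_graph G w"
    and "infinity_graph G"
    and "card (pverts G) = n"
    and "\<exists>v. pendant G v"
    and "distinct xs" and "set xs = pverts G"
  shows "3 \<le> i_pos (adjacency_matrix G w xs)
       \<and> 3 \<le> i_neg (adjacency_matrix G w xs)
       \<and> int (i_zero (adjacency_matrix G w xs)) \<le> int n - 6"
proof -
  let ?A = "adjacency_matrix G w xs"
  have pg: "pair_graph G" using assms(1) by (simp add: weighted_graph_def)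
  note psym = pair_graph_sym[OF pg]
  have n: "length xs = n" using assms(3,5,6) distinct_card[of xs] by simp
  define W where "W x y = (if (x, y) \<in> parcs G then w {x, y} else 0)" for x y
  have W_nonzero: "W x y \<noteq> 0" if "(x, y) \<in> parcs G" for x y
  proof -
    have "{x, y} \<in> edges G" using that doubleton_in_edges_iff[OF pg] by blast
    then have "0 < w {x, y}" using assms(1) unfolding weighted_graph_def by blast
    then show ?thesis using that by (simp add: W_def)
  qed
  \<comment> \<open>The position of a vertex in \<open>xs\<close>, so that matrix entries can be
    read as weights \<open>W\<close> between vertices.\<close>
  define ix where "ix v = (SOME i. i < n \<and> xs ! i = v)" for v
  have ix: "ix v < n \<and> xs ! ix v = v" if "v \<in> pverts G" for v
    unfolding ix_def by (rule someI_ex) (use that assms(6) n in \<open>auto simp: in_set_conv_nth\<close>)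
  have A: "?A \<in> carrier_mat n n" by (simp add: adjacency_matrix_def n)
  have sym: "?A $$ (i, j) = ?A $$ (j, i)" if "i < n" "j < n" for i j
    using that psym n by (auto simp: adjacency_matrix_def insert_commute)
  have entry: "?A $$ (ix x, ix y) = W x y" if "x \<in> pverts G" "y \<in> pverts G" for x y
    using ix[OF that(1)] ix[OF that(2)] n by (simp add: adjacency_matrix_def W_def)
  obtain v1 where v1: "pendant G v1" using assms(4) by blast
  then have "card {e \<in> parcs G. fst e = v1} = 1"
    by (simp add: pendant_def out_degree_def out_arcs_def)
  then obtain e where e: "{e \<in> parcs G. fst e = v1} = {e}" by (auto simp: card_1_singleton_iff)
  then have "e \<in> parcs G" "fst e = v1" by auto
  then obtain u1 where e1: "(v1, u1) \<in> parcs G" by (metis prod.collapse)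
  have only: "y = u1" if "(v1, y) \<in> parcs G" for y
  proof -
    have "(v1, y) \<in> {e}" "(v1, u1) \<in> {e}" unfolding e[symmetric] using that e1 by auto
    then show ?thesis by auto
  qed
  \<comment> \<open>The avoided vertex is the unique neighbour \<open>u1\<close> of the pendant
    vertex.\<close>
  obtain u2 v2 u3 v3 where e2: "(u2, v2) \<in> parcs G" and e3: "(u3, v3) \<in> parcs G"
    and no: "(v2, u3) \<notin> parcs G" "(v2, v3) \<notin> parcs G"
    and avoid: "u1 \<notin> {u2, v2, u3, v3}" and disj: "{u2, v2} \<inter> {u3, v3} = {}"
    by (rule infinity_graph_half_induced_matching[OF assms(2), of u1])
  have irr: "(x, x) \<notin> parcs G" for x by (rule pair_graph_irrefl[OF pg])
  have in_verts: "{u1, u2, u3, v1, v2, v3} \<subseteq> pverts G"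
    using pair_graph_wf[OF pg e1] pair_graph_wf[OF pg e2] pair_graph_wf[OF pg e3] by simp
  have no1: "(v1, y) \<notin> parcs G" "(y, v1) \<notin> parcs G" if "y \<noteq> u1" for y
    using only psym that by blast+
  \<comment> \<open>If \<open>v1\<close> were an end of one of the two edges, the other end would be
    \<open>u1\<close>, which was avoided.\<close>
  have v1_new: "v1 \<notin> {u1, u2, v2, u3, v3}"
    using no1(1)[of v2] no1(2)[of u2] no1(1)[of v3] no1(2)[of u3] e1 e2 e3 avoid irr[of v1] by auto
  have dist: "distinct [u1, u2, u3, v1, v2, v3]"
    using avoid disj v1_new e2 e3 irr[of u2] irr[of u3] by auto
  have inj_ix: "ix x = ix y \<longleftrightarrow> x = y" if "x \<in> pverts G" "y \<in> pverts G" for x y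
    using ix[OF that(1)] ix[OF that(2)] by metis
  let ?U = "{ix u1, ix u2, ix u3}" and ?V = "{ix v1, ix v2, ix v3}"
  have distix: "distinct [ix u1, ix u2, ix u3, ix v1, ix v2, ix v3]"
    using dist in_verts by (simp add: inj_ix)
  have no': "(v3, v2) \<notin> parcs G" "(u3, v2) \<notin> parcs G" using no psym by blast+
  \<comment> \<open>The entries among \<open>v1\<close>, \<open>v2\<close>, \<open>v3\<close> give
    isotropy; the last three are those below the diagonal of the block.\<close>
  have z: "W v1 v1 = 0" "W v1 v2 = 0" "W v1 v3 = 0" "W v2 v1 = 0" "W v3 v1 = 0" "W v2 v2 = 0" "W v3 v3 = 0"
    "W v2 v3 = 0" "W v3 v2 = 0" "W u2 v1 = 0" "W u3 v1 = 0" "W u3 v2 = 0"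
    using no no' no1 avoid v1_new irr by (auto simp: W_def)
  have nz: "W u1 v1 \<noteq> 0" "W u2 v2 \<noteq> 0" "W u3 v3 \<noteq> 0"
    using W_nonzero[OF psym[OF e1]] W_nonzero[OF e2] W_nonzero[OF e3] by auto
  have "card ?V \<le> i_pos ?A \<and> card ?V \<le> i_neg ?A \<and> i_zero ?A + 2 * card ?V \<le> n"
  proof (rule symmetric_inertia_ge[OF A sym, where U = ?U and V = ?V])
    show "?U \<subseteq> {..<n}" "?V \<subseteq> {..<n}" using ix in_verts by auto
    show "?U \<inter> ?V = {}" using distix by auto
    show "?A $$ (i, j) = 0" if "i \<in> ?V" "j \<in> ?V" for i j
      using that z in_verts by (auto simp: entry)
    fix x v assume eq: "\<And>u. u \<in> ?U \<Longrightarrow> (\<Sum>v\<in>?V. ?A $$ (u, v) * x v) = 0" and v: "v \<in> ?V"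
    have row: "W u v1 * x (ix v1) + W u v2 * x (ix v2) + W u v3 * x (ix v3) = 0"
      if "u \<in> {u1, u2, u3}" for u
      using eq[of "ix u"] that distix in_verts by (auto simp: entry add.assoc)
    \<comment> \<open>Back substitution in the upper triangular system, from the last row
      up.\<close>
    have "x (ix v3) = 0" using row[of u3] z nz by simp
    moreover from this have "x (ix v2) = 0" using row[of u2] z nz by simp
    moreover from calculation have "x (ix v1) = 0" using row[of u1] nz by simp
    ultimately show "x v = 0" using v by auto
  qed
  moreover have "card ?V = 3" using distix by simp
  ultimately show ?thesis by simp
qed

end
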